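(* Let $x,y$ be formal variables. In $\mathcal{A}[[x,y]]$, we have $$1+\sum_{r\ge1}\sum_{k\ge2r}M(k,r)\,x^{k-2r}y^r=\exp\left\{\sum_{n\ge1}\frac{\zeta_{\mathcal{A}}^{(2)}(n)}{n}\left(x^n-\gamma^n-\delta^n\right)\right\},$$ where $\gamma$ and $\delta$ are formally determined by $$\gamma+\delta=x,\qquad\gamma\delta=y.$$
   Context: Let $\mathcal{P}$ be the set of prime numbers and $\mathcal{A}=\prod_{p\in\mathcal{P}}\mathbb{Z}/p\mathbb{Z}\big/\bigoplus_{p\in\mathcal{P}}\mathbb{Z}/p\mathbb{Z}$, which is a $\mathbb{Q}$-algebra. For a finite sequence of positive integers $(k_1,\ldots,k_r)$, the level-two finite multiple zeta value is $$\zeta_{\mathcal{A}}^{(2)}(k_1,\ldots,k_r)=\left(\sum_{0<n_1<\cdots<n_r<p/2}\frac{1}{n_1^{k_1}\cdots n_r^{k_r}}\bmod p\right)_{p}\in\mathcal{A}.$$ For $r\ge1$ and $k\ge2r$, $$M(k,r)=\sum_{\substack{k_1+\cdots+k_r=k\\ k_j\ge2\ (1\le j\le r)}}\zeta_{\mathcal{A}}^{(2)}(k_1,\ldots,k_r).$$ Only the symmetric combinations $\gamma^n+\delta^n$ occur; each is understood as the corresponding polynomial in $\gamma+\delta=x$ and $\gamma\delta=y$, so that the right-hand side is well defined in $\mathcal{A}[[x,y]]$. *)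

theory Defs
  imports
    "HOL-Computational_Algebra.Computational_Algebra"
    "HOL-Number_Theory.Number_Theory"
begin

section \<open>The ring of integers modulo infinitely large primes\<close>

text \<open>
  An element of the product of the rings \<open>\<int>/p\<int>\<close> is represented by a family of integers, read
  modulo \<open>p\<close> in its \<open>p\<close>-th component; the values at non-primes are irrelevant. Two families
  are identified if their difference lies in the direct sum, i.e. if they agree modulo \<open>p\<close>
  for all but finitely many primes \<open>p\<close>.
\<close>

definition prime_ae_cong :: "(nat \<Rightarrow> int) \<Rightarrow> (nat \<Rightarrow> int) \<Rightarrow> bool" where
  "prime_ae_cong f g \<longleftrightarrow> finite {p. prime p \<and> \<not> [f p = g p] (mod int p)}"

lemma prime_ae_congI:
  assumes "finite A" "\<And>p. prime p \<Longrightarrow> p \<notin> A \<Longrightarrow> [f p = g p] (mod int p)"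
  shows "prime_ae_cong f g"
  unfolding prime_ae_cong_def by (rule finite_subset[OF _ assms(1)]) (use assms(2) in auto)

lemma prime_ae_cong_mono2:
  assumes "prime_ae_cong f g" "prime_ae_cong f' g'"
  assumes "\<And>p. [f p = g p] (mod int p) \<Longrightarrow> [f' p = g' p] (mod int p) \<Longrightarrow>
             [h p = h' p] (mod int p)"
  shows "prime_ae_cong h h'"
  using assms
  by (intro prime_ae_congI[of "{p. prime p \<and> \<not> [f p = g p] (mod int p)} \<union>
                               {p. prime p \<and> \<not> [f' p = g' p] (mod int p)}"])
     (auto simp: prime_ae_cong_def)

lemma prime_ae_cong_refl [simp]: "prime_ae_cong f f"
  by (simp add: prime_ae_cong_def)

lemma equivp_prime_ae_cong: "equivp prime_ae_cong"
proof (rule equivpI)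
  show "reflp prime_ae_cong"
    by (simp add: reflp_def)
  show "symp prime_ae_cong"
    by (auto simp: symp_def prime_ae_cong_def cong_sym_eq)
  show "transp prime_ae_cong"
    by (rule transpI) (erule (1) prime_ae_cong_mono2, rule cong_trans)
qed

quotient_type ring_A = "nat \<Rightarrow> int" / prime_ae_cong
  by (rule equivp_prime_ae_cong)

instantiation ring_A :: comm_ring_1
begin

lift_definition zero_ring_A :: ring_A is "\<lambda>_. 0" .
lift_definition one_ring_A :: ring_A is "\<lambda>_. 1" .
lift_definition plus_ring_A :: "ring_A \<Rightarrow> ring_A \<Rightarrow> ring_A" is "\<lambda>f g p. f p + g p"
  by (erule (1) prime_ae_cong_mono2) (rule cong_add)
lift_definition times_ring_A :: "ring_A \<Rightarrow> ring_A \<Rightarrow> ring_A" is "\<lambda>f g p. f p * g p"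
  by (erule (1) prime_ae_cong_mono2) (rule cong_mult)
lift_definition minus_ring_A :: "ring_A \<Rightarrow> ring_A \<Rightarrow> ring_A" is "\<lambda>f g p. f p - g p"
  by (erule (1) prime_ae_cong_mono2) (rule cong_diff)
lift_definition uminus_ring_A :: "ring_A \<Rightarrow> ring_A" is "\<lambda>f p. - f p"
  by (erule prime_ae_cong_mono2[OF _ prime_ae_cong_refl]) (simp add: cong_minus_minus_iff)

instance
proof
  show "(0 :: ring_A) \<noteq> 1"
  proof transfer
    have "{p::nat. prime p \<and> \<not> [0 = 1] (mod int p)} = {p. prime p}"
      by (auto simp: cong_iff_dvd_diff)
    thus "\<not> prime_ae_cong (\<lambda>_. 0) (\<lambda>_. 1)"
      using primes_infinite by (simp add: prime_ae_cong_def)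
  qed
qed (transfer; simp add: algebra_simps)+

end

text \<open>
  The \<open>\<rat>\<close>-algebra structure: a rational number acts on the \<open>p\<close>-th component through its
  residue modulo \<open>p\<close>, which makes sense for every \<open>p\<close> not dividing the denominator.
\<close>

definition rat_residue :: "nat \<Rightarrow> rat \<Rightarrow> int" where
  "rat_residue p q = fst (quotient_of q) * modular_inverse (int p) (snd (quotient_of q))"

lift_definition scaleQ :: "rat \<Rightarrow> ring_A \<Rightarrow> ring_A" is "\<lambda>q f p. rat_residue p q * f p"
  by (erule prime_ae_cong_mono2[OF _ prime_ae_cong_refl]) (intro cong_mult cong_refl)

lemma rat_residue_cong:
  assumes "q = of_int a / of_int b" "coprime b (int p)" "b \<noteq> 0"
  shows   "[b * rat_residue p q = a] (mod int p)"
proof -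
  obtain c d where cd: "quotient_of q = (c, d)" by force
  have d: "d > 0" "coprime c d" "q = of_int c / of_int d"
    using quotient_of_denom_pos[OF cd] quotient_of_coprime[OF cd] quotient_of_div[OF cd] by auto
  have "of_int (a * d) = (of_int (c * b) :: rat)"
    using assms d by (simp add: field_simps)
  hence eq: "a * d = c * b" by (simp only: of_int_eq_iff)
  hence "d dvd c * b" by (metis dvd_triv_right)
  hence "d dvd b"
    using coprime_dvd_mult_right_iff[of d c b] \<open>coprime c d\<close> by (simp add: coprime_commute)
  hence cop: "coprime d (int p)"
    using assms(2) coprime_divisors[of d b "int p" "int p"] by simp
  obtain e where e: "b = d * e" using \<open>d dvd b\<close> by blast
  have a: "a = c * e" using eq e d(1) by simp
  have "[(d * modular_inverse (int p) d) * (c * e) = 1 * (c * e)] (mod int p)"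
    by (intro cong_mult cong_refl cong_modular_inverse1 cop)
  thus ?thesis by (simp add: rat_residue_def cd e a mult_ac)
qed

lemma rat_residue_cong_iff:
  assumes "q = of_int a / of_int b" "coprime b (int p)" "b \<noteq> 0" "[b * z = a] (mod int p)"
  shows   "[rat_residue p q = z] (mod int p)"
proof -
  have "[b * rat_residue p q = b * z] (mod int p)"
    by (rule cong_trans[OF rat_residue_cong[OF assms(1-3)] cong_sym[OF assms(4)]])
  thus ?thesis by (simp only: cong_mult_lcancel[OF assms(2)])
qed

lemma finite_bad_primes:
  assumes "b \<noteq> (0 :: int)"
  shows "finite {p. prime p \<and> \<not> coprime b (int p)}"
proof -
  have "p \<le> nat \<bar>b\<bar>" if "prime p" "\<not> coprime b (int p)" for p
  proof -
    have "int p dvd b"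
      using that prime_imp_coprime[of "int p" b] by (auto simp: coprime_commute)
    hence "int p \<le> \<bar>b\<bar>" using dvd_imp_le_int[OF assms] by fastforce
    thus ?thesis by linarith
  qed
  hence "{p. prime p \<and> \<not> coprime b (int p)} \<subseteq> {..nat \<bar>b\<bar>}" by blast
  thus ?thesis by (rule finite_subset) simp
qed

lemma vector_space_scaleQ: "vector_space scaleQ"
proof
  fix q r :: rat and u v :: ring_A
  show "scaleQ q (u + v) = scaleQ q u + scaleQ q v"
    by transfer (simp add: algebra_simps)
  obtain a b where q: "q = of_int a / of_int b" "b > 0"
    by (metis prod.collapse quotient_of_denom_pos quotient_of_div)
  obtain c d where r: "r = of_int c / of_int d" "d > 0"
    by (metis prod.collapse quotient_of_denom_pos quotient_of_div)
  have bd: "b * d \<noteq> 0" using q r by simp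
  have res: "[b * rat_residue p q = a] (mod int p)" "[d * rat_residue p r = c] (mod int p)"
    if "coprime (b * d) (int p)" for p
    using that q r by (auto intro!: rat_residue_cong)
  have *: "[rat_residue p (q + r) = rat_residue p q + rat_residue p r] (mod int p)"
    if p: "coprime (b * d) (int p)" for p
  proof (rule rat_residue_cong_iff[OF _ p bd])
    show "q + r = of_int (a * d + c * b) / of_int (b * d)"
      using q r by (simp add: field_simps)
    have "[d * (b * rat_residue p q) + b * (d * rat_residue p r) = d * a + b * c] (mod int p)"
      by (intro cong_add cong_mult cong_refl res p)
    thus "[b * d * (rat_residue p q + rat_residue p r) = a * d + c * b] (mod int p)"
      by (simp add: algebra_simps)
  qed
  show "scaleQ (q + r) u = scaleQ q u + scaleQ r u"
  proof (transfer fixing: q r)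
    fix f :: "nat \<Rightarrow> int"
    show "prime_ae_cong (\<lambda>p. rat_residue p (q + r) * f p)
            (\<lambda>p. rat_residue p q * f p + rat_residue p r * f p)"
      by (rule prime_ae_congI[OF finite_bad_primes[OF bd]])
         (auto simp flip: distrib_right intro!: cong_mult cong_refl *)
  qed
  have *: "[rat_residue p (q * r) = rat_residue p q * rat_residue p r] (mod int p)"
    if p: "coprime (b * d) (int p)" for p
  proof (rule rat_residue_cong_iff[OF _ p bd])
    show "q * r = of_int (a * c) / of_int (b * d)"
      using q r by (simp add: field_simps)
    have "[(b * rat_residue p q) * (d * rat_residue p r) = a * c] (mod int p)"
      by (intro cong_mult res p)
    thus "[b * d * (rat_residue p q * rat_residue p r) = a * c] (mod int p)"
      by (simp add: algebra_simps)
  qed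
  show "scaleQ q (scaleQ r u) = scaleQ (q * r) u"
  proof (transfer fixing: q r)
    fix f :: "nat \<Rightarrow> int"
    show "prime_ae_cong (\<lambda>p. rat_residue p q * (rat_residue p r * f p))
            (\<lambda>p. rat_residue p (q * r) * f p)"
      by (rule prime_ae_congI[OF finite_bad_primes[OF bd]])
         (auto simp flip: mult.assoc intro!: cong_mult cong_refl cong_sym[OF *])
  qed
next
  show "scaleQ 1 u = u" for u
  proof transfer
    fix f :: "nat \<Rightarrow> int"
    have "[rat_residue p 1 = 1] (mod int p)" for p
      by (rule rat_residue_cong_iff[of _ 1 1]) auto
    from cong_mult[OF this cong_refl]
    show "prime_ae_cong (\<lambda>p. rat_residue p 1 * f p) f"
      by (intro prime_ae_congI[of "{}"]) (auto)
  qed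
qed

lemma scaleQ_mult_left: "scaleQ q u * v = scaleQ q (u * v)"
  by transfer (simp add: mult.assoc)


section \<open>Level-two finite multiple zeta values\<close>

text \<open>
  For \<open>0 < n < p/2\<close> the number \<open>n\<close> is invertible modulo the prime \<open>p\<close>, so the convention of
  \<^const>\<open>modular_inverse\<close> for non-invertible arguments never comes into play.
\<close>

definition fmzv2_residue :: "nat list \<Rightarrow> nat \<Rightarrow> int" where
  "fmzv2_residue ks p =
     (\<Sum>ns | length ns = length ks \<and> sorted_wrt (<) ns \<and> (\<forall>n\<in>set ns. 0 < n \<and> 2 * n < p).
        \<Prod>i<length ks. modular_inverse (int p) (int (ns ! i)) ^ (ks ! i))"

lift_definition fmzv2 :: "nat list \<Rightarrow> ring_A" is fmzv2_residue .

definition fmzv2_sum :: "nat \<Rightarrow> nat \<Rightarrow> ring_A" where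
  "fmzv2_sum k r = (\<Sum>ks | length ks = r \<and> sum_list ks = k \<and> (\<forall>j\<in>set ks. 2 \<le> j). fmzv2 ks)"

lemma finite_fmzv2_residue_index:
  "finite {ns. length ns = l \<and> sorted_wrt (<) ns \<and> (\<forall>n\<in>set ns. 0 < n \<and> 2 * n < (p :: nat))}"
  by (rule finite_subset[OF _ finite_lists_length_eq[of "{..<p}" l]]) auto

lemma finite_fmzv2_sum_index:
  "finite {ks. length ks = r \<and> sum_list ks = (k :: nat) \<and> (\<forall>j\<in>set ks. 2 \<le> j)}"
  by (rule finite_subset[OF _ finite_lists_length_eq[of "{..k}" r]])
     (auto simp: member_le_sum_list)


section \<open>Formal power series in two variables\<close>

text \<open>
  \<open>R[[x,y]]\<close> is rendered as \<open>R[[x]][[y]]\<close>: the coefficient of \<open>x\<^sup>a y\<^sup>b\<close> in \<open>F\<close> is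
  \<open>fps_nth (fps_nth F b) a\<close>.
\<close>

definition var_x :: "'a::comm_ring_1 fps fps" where "var_x = fps_const fps_X"
definition var_y :: "'a::comm_ring_1 fps fps" where "var_y = fps_X"
definition const2 :: "'a::comm_ring_1 \<Rightarrow> 'a fps fps" where "const2 c = fps_const (fps_const c)"

text \<open>
  Infinite formal sums are taken coefficientwise. They are meaningful if the family is locally
  finite, i.e. if every monomial occurs in only finitely many members. (The topology on \<open>fps\<close>
  is not suitable here, since on the nested type it is only the \<open>y\<close>-adic one.)
\<close>

definition formal_sum :: "nat set \<Rightarrow> (nat \<Rightarrow> 'a::comm_ring_1 fps fps) \<Rightarrow> 'a fps fps" where
  "formal_sum I F =
     Abs_fps (\<lambda>b. Abs_fps (\<lambda>a. \<Sum>i | i \<in> I \<and> fps_nth (fps_nth (F i) b) a \<noteq> 0.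
                                    fps_nth (fps_nth (F i) b) a))"

definition locally_finite_family :: "nat set \<Rightarrow> (nat \<Rightarrow> 'a::comm_ring_1 fps fps) \<Rightarrow> bool" where
  "locally_finite_family I F \<longleftrightarrow> (\<forall>a b. finite {i \<in> I. fps_nth (fps_nth (F i) b) a \<noteq> 0})"

definition formal_exp :: "ring_A fps fps \<Rightarrow> ring_A fps fps" where
  "formal_exp F = formal_sum UNIV (\<lambda>m. const2 (scaleQ (1 / fact m) 1) * F ^ m)"

text \<open>
  \<open>pow_sum n s t\<close> is the integer polynomial in \<open>s\<close> and \<open>t\<close> that represents \<open>\<gamma>\<^sup>n + \<delta>\<^sup>n\<close> for
  \<open>s = \<gamma> + \<delta>\<close> and \<open>t = \<gamma>\<delta>\<close>, given by Newton's recursion; see \<open>pow_sum_eq\<close>.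
\<close>

fun pow_sum :: "nat \<Rightarrow> 'a::comm_ring_1 \<Rightarrow> 'a \<Rightarrow> 'a" where
  "pow_sum 0 s t = 2"
| "pow_sum (Suc 0) s t = s"
| "pow_sum (Suc (Suc n)) s t = s * pow_sum (Suc n) s t - t * pow_sum n s t"

lemma pow_sum_eq:
  fixes \<gamma> \<delta> s t :: "'a :: comm_ring_1"
  assumes "\<gamma> + \<delta> = s" "\<gamma> * \<delta> = t"
  shows   "pow_sum n s t = \<gamma> ^ n + \<delta> ^ n"
  unfolding assms[symmetric]
  by (induction n "\<gamma> + \<delta>" "\<gamma> * \<delta>" rule: pow_sum.induct) (simp_all add: algebra_simps)


subsection \<open>Local finiteness of the families in the theorem\<close>

lemma var_x_power_nth: "fps_nth (fps_nth (var_x ^ n) b) a = (if b = 0 \<and> a = n then 1 else 0)"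
  by (simp add: var_x_def fps_const_power fps_X_power_nth)

lemma const2_mult_nth: "fps_nth (fps_nth (const2 c * F) b) a = c * fps_nth (fps_nth F b) a"
  by (simp add: const2_def)

lemma monomial2_nth:
  "fps_nth (fps_nth (const2 c * var_x ^ m * var_y ^ n) b) a = (if a = m \<and> b = n then c else 0)"
proof -
  have "const2 c * var_x ^ m * var_y ^ n = fps_X ^ n * (const2 c * var_x ^ m)"
    by (simp add: var_y_def mult_ac)
  moreover have "fps_nth (fps_nth (const2 c * var_x ^ m) 0) a = (if a = m then c else 0)"
    by (simp add: const2_mult_nth var_x_power_nth del: fps_mult_nth_0)
  moreover have "fps_nth (fps_nth (const2 c * var_x ^ m) (b - n)) a = 0" if "n < b"
    using that by (simp add: const2_mult_nth var_x_power_nth)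
  ultimately show ?thesis
    by (cases n b rule: linorder_cases) (auto simp: fps_X_power_mult_nth simp del: fps_mult_nth_0)
qed

lemma locally_finite_lhs_inner:
  "locally_finite_family {2 * r..} (\<lambda>k. const2 (c k) * var_x ^ (k - 2 * r) * var_y ^ r)"
  unfolding locally_finite_family_def
proof (intro allI)
  show "finite {k \<in> {2 * r..}. fps_nth (fps_nth
          (const2 (c k) * var_x ^ (k - 2 * r) * var_y ^ r) b) a \<noteq> 0}" for a b
    by (rule finite_subset[of _ "{a + 2 * r}"]) (auto simp: monomial2_nth split: if_splits)
qed

lemma locally_finite_lhs_outer:
  "locally_finite_family {1..}
     (\<lambda>r. formal_sum {2 * r..} (\<lambda>k. const2 (c k r) * var_x ^ (k - 2 * r) * var_y ^ r))"
  unfolding locally_finite_family_def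
proof (intro allI)
  show "finite {r \<in> {1..}. fps_nth (fps_nth (formal_sum {2 * r..}
          (\<lambda>k. const2 (c k r) * var_x ^ (k - 2 * r) * var_y ^ r)) b) a \<noteq> 0}" for a b
    by (rule finite_subset[of _ "{b}"])
       (auto simp: formal_sum_def monomial2_nth intro!: sum.neutral split: if_splits)
qed

lemma pow_sum_nth_eq_0:
  assumes "a + 2 * b \<noteq> n"
  shows   "fps_nth (fps_nth (pow_sum n var_x var_y) b) a = (0 :: 'a :: comm_ring_1)"
  using assms
proof (induction n arbitrary: a b rule: induct_nat_012)
  case 0
  have two: "(2 :: 'a fps fps) = const2 2"
    by (simp add: const2_def numeral_fps_const)
  show ?case using 0 unfolding pow_sum.simps two by (auto simp: const2_def)
next
  case 1
  thus ?case by (auto simp: var_x_def fps_X_nth)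
next
  case (ge2 n)
  have "fps_nth (fps_nth (var_x * F) b) a = (if a = 0 then 0 else fps_nth (fps_nth F b) (a - 1))"
    for F :: "'a fps fps"
    by (simp add: var_x_def)
  moreover have "fps_nth (fps_nth (var_y * F) b) a =
                   (if b = 0 then 0 else fps_nth (fps_nth F (b - 1)) a)"
    for F :: "'a fps fps"
    by (simp add: var_y_def)
  ultimately show ?case
    using ge2.prems ge2.IH(1)[of a "b - 1"] ge2.IH(2)[of "a - 1" b] by auto
qed

lemma locally_finite_exponent:
  "locally_finite_family I (\<lambda>n. const2 (c n :: 'a :: comm_ring_1) * (var_x ^ n - pow_sum n var_x var_y))"
  unfolding locally_finite_family_def
proof (intro allI)
  show "finite {n \<in> I. fps_nth (fps_nth
          (const2 (c n) * (var_x ^ n - pow_sum n var_x var_y)) b) a \<noteq> 0}" for a b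
  proof (rule finite_subset[of _ "{a + 2 * b}"])
    have "fps_nth (fps_nth (const2 (c n) * (var_x ^ n - pow_sum n var_x var_y)) b) a = 0"
      if "n \<noteq> a + 2 * b" for n
      using that pow_sum_nth_eq_0[of a b n, where ?'a = 'a]
      by (auto simp: const2_mult_nth var_x_power_nth simp del: fps_mult_nth_0)
    thus "{n \<in> I. fps_nth (fps_nth
            (const2 (c n) * (var_x ^ n - pow_sum n var_x var_y)) b) a \<noteq> 0} \<subseteq> {a + 2 * b}"
      by blast
  qed simp
qed

lemma exponent_nth_0_0:
  "fps_nth (fps_nth (formal_sum {1..}
     (\<lambda>n. const2 (c n) * (var_x ^ n - pow_sum n var_x var_y))) 0) 0 = 0"
  by (auto simp: formal_sum_def const2_mult_nth var_x_power_nth pow_sum_nth_eq_0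
           intro!: sum.neutral simp del: fps_mult_nth_0)

lemma power_nth_nth_eq_0:
  assumes "fps_nth (fps_nth F 0) 0 = 0" "a + b < m"
  shows   "fps_nth (fps_nth (F ^ m) b) a = (0 :: 'a :: comm_ring_1)"
  using assms(2)
proof (induction m arbitrary: a b)
  case (Suc m)
  have "fps_nth (fps_nth F i) j * fps_nth (fps_nth (F ^ m) (b - i)) (a - j) = 0"
    if "i \<le> b" "j \<le> a" for i j
  proof (cases "i = 0 \<and> j = 0")
    case False
    hence "(a - j) + (b - i) < m" using Suc.prems that by linarith
    thus ?thesis using Suc.IH by simp
  qed (use assms(1) in auto)
  thus ?case
    by (auto simp: fps_mult_nth fps_sum_nth intro!: sum.neutral)
qed simp

lemma locally_finite_exp:
  assumes "fps_nth (fps_nth F 0) 0 = 0"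
  shows   "locally_finite_family UNIV (\<lambda>m. const2 (c m) * F ^ m)"
  unfolding locally_finite_family_def
proof (intro allI)
  show "finite {m \<in> UNIV. fps_nth (fps_nth (const2 (c m) * F ^ m) b) a \<noteq> 0}" for a b
  proof (rule finite_subset[of _ "{..a + b}"])
    have "fps_nth (fps_nth (const2 (c m) * F ^ m) b) a = 0" if "a + b < m" for m
      using power_nth_nth_eq_0[OF assms that] by (simp add: const2_mult_nth del: fps_mult_nth_0)
    thus "{m \<in> UNIV. fps_nth (fps_nth (const2 (c m) * F ^ m) b) a \<noteq> 0} \<subseteq> {..a + b}"
      by (auto simp: not_less[symmetric] simp del: fps_mult_nth_0)
  qed simp
qed

end

theory Submission
  imports Defs
begin

text \<open>
  Fix a prime \<open>p\<close> and let \<open>u\<close> run over the inverses of the integers \<open>0 < n < p/2\<close>. Collecting the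
  sums over all exponents \<open>\<ge> 2\<close> into geometric series shows that the left-hand side has the
  \<open>p\<close>-th component
    \<open>\<Prod>\<^sub>u (1 + y (u\<^sup>2 + x u\<^sup>3 + x\<^sup>2 u\<^sup>4 + \<dots>)) = \<Prod>\<^sub>u (1 - x u + y u\<^sup>2) / (1 - x u)\<close>.
  Since \<open>1 - x u + y u\<^sup>2 = (1 - \<gamma> u) (1 - \<delta> u)\<close>, taking logarithms yields the claim formally, with
  \<open>\<Sum>\<^sub>u u\<^sup>n\<close> being the \<open>p\<close>-th component of \<open>\<zeta>(n)\<close>.

  The logarithm has denominators, which are not invertible modulo every \<open>p\<close>. This is avoided by
  comparing logarithmic derivatives with respect to \<open>y\<close>. For one factor this derivative is
    \<open>u\<^sup>2 / (1 - x u + y u\<^sup>2) = \<Sum>\<^sub>a\<^sub>,\<^sub>b (-1)\<^sup>b (a + b choose b) u\<^bsup>a + 2 b + 2\<^esup> x\<^sup>a y\<^sup>b\<close>,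
  which is an identity of integer series (\<open>fps_deriv_elem_factor\<close>). So the equation \<open>F' = F K\<close> holds
  exactly in \<open>\<int>[[x,y]]\<close> for each \<open>p\<close>, with no congruences involved, and a ring homomorphism that
  commutes with \<open>d/dy\<close> (\<open>series_of_family\<close>) carries it over to \<open>\<A>[[x,y]]\<close>.

  On the other side, the exponent is divisible by \<open>y\<close> because \<open>\<gamma>\<^sup>n + \<delta>\<^sup>n\<close> specialises to \<open>x\<^sup>n\<close> at \<open>y = 0\<close>
  for \<open>n \<ge> 1\<close>; hence its exponential satisfies the usual differential equation
  (\<open>fps_deriv_formal_exp\<close>). Waring's formula for \<open>\<gamma>\<^sup>n + \<delta>\<^sup>n\<close> (\<open>pow_sum_nth\<close>, \<open>waring_coeff_Suc\<close>) shows
  that differentiation cancels the factors \<open>1/n\<close> and that the derivative of the exponent is the same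
  series \<open>K\<close>. Both sides are \<open>1\<close> at \<open>y = 0\<close>, and as \<open>\<A>\<close> is torsion-free, the equation
  \<open>F' = F K\<close> has only one solution with a given value at \<open>y = 0\<close> (\<open>logarithmic_derivative_unique\<close>).
\<close>

section \<open>Exponentials of series divisible by y\<close>

lemma scaleQ_eq_mult: "scaleQ q z = scaleQ q 1 * z"
  by (simp add: scaleQ_mult_left)

lemma scaleQ_scaleQ_one: "scaleQ q 1 * scaleQ r 1 = scaleQ (q * r) 1"
  by (simp add: scaleQ_mult_left vector_space.vector_space_assms(3)[OF vector_space_scaleQ])

lemma scaleQ_of_nat: "scaleQ (of_nat n) 1 = of_nat n"
proof (induction n)
  case 0
  show ?case
    using vector_space.vector_space_assms(2)[OF vector_space_scaleQ, of 0 0 1] by simp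
next
  case (Suc n)
  have "scaleQ (of_nat n + 1) 1 = scaleQ (of_nat n) 1 + scaleQ 1 1"
    by (rule vector_space.vector_space_assms(2)[OF vector_space_scaleQ])
  also have "scaleQ 1 1 = 1"
    by (rule vector_space.vector_space_assms(4)[OF vector_space_scaleQ])
  finally show ?case
    using Suc.IH by (simp add: add_ac)
qed

lemma of_nat_mult_scaleQ_inverse:
  assumes "n > 0"
  shows   "of_nat n * scaleQ (1 / of_nat n) z = z"
proof -
  have "of_nat n * scaleQ (1 / of_nat n) z = (scaleQ (of_nat n) 1 * scaleQ (1 / of_nat n) 1) * z"
    by (subst scaleQ_eq_mult) (simp add: scaleQ_of_nat mult.assoc)
  also have "\<dots> = scaleQ 1 1 * z"
    using assms by (simp add: scaleQ_scaleQ_one)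
  also have "\<dots> = z"
    using scaleQ_of_nat[of 1] by simp
  finally show ?thesis .
qed

lemma of_nat_Suc_mult_eq_0_ring_A:
  fixes z :: ring_A
  assumes "of_nat (Suc n) * z = 0"
  shows   "z = 0"
proof -
  have "z = of_nat (Suc n) * z * scaleQ (1 / of_nat (Suc n)) 1"
    using of_nat_mult_scaleQ_inverse[of "Suc n" 1] by (simp only: mult_ac mult_1_right) simp
  thus ?thesis
    by (simp only: assms mult_zero_left)
qed

text \<open>
  Comparing the coefficients of \<open>y\<^sup>c\<close> in \<open>F' = F K\<close> expresses \<open>(c + 1) F\<^bsub>c + 1\<^esub>\<close> through the earlier
  coefficients of \<open>F\<close>, and multiplication by \<open>c + 1\<close> is injective. The derivative is the one with
  respect to the outer variable \<open>y\<close>, here and in what follows.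
\<close>

lemma logarithmic_derivative_unique:
  fixes F H K :: "ring_A fps fps"
  assumes "fps_deriv F = F * K" "fps_deriv H = H * K" "fps_nth F 0 = fps_nth H 0"
  shows   "F = H"
proof (rule fps_ext)
  fix b
  show "fps_nth F b = fps_nth H b"
  proof (induction b rule: less_induct)
    case (less b)
    show ?case
    proof (cases b)
      case 0
      thus ?thesis using assms(3) by simp
    next
      case (Suc c)
      have "fps_nth (F * K) c = fps_nth (H * K) c"
        using less Suc by (auto simp: fps_mult_nth intro!: sum.cong)
      hence "fps_nth (fps_deriv F) c = fps_nth (fps_deriv H) c"
        by (simp only: assms)
      hence eq: "of_nat (Suc c) * (fps_nth F b - fps_nth H b) = 0"
        using Suc by (simp add: algebra_simps)
      have "fps_nth (fps_nth F b - fps_nth H b) a = 0" for a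
      proof (rule of_nat_Suc_mult_eq_0_ring_A)
        have "fps_nth (fps_const (of_nat (Suc c)) * (fps_nth F b - fps_nth H b)) a = 0"
          unfolding fps_of_nat eq by simp
        thus "of_nat (Suc c) * fps_nth (fps_nth F b - fps_nth H b) a = 0"
          by (simp only: fps_mult_left_const_nth)
      qed
      thus ?thesis
        by (simp add: fps_eq_iff)
    qed
  qed
qed

text \<open>
  A formal exponential is an infinite sum that is only taken coefficientwise, so it cannot be
  differentiated term by term directly. If the exponent is divisible by \<open>y\<close>, however, then
  its coefficients at \<open>y\<^sup>b\<close> with \<open>b \<le> N\<close> are those of the partial sum up to \<open>N\<close>, to which the rules
  for derivatives of finite sums and products apply.
\<close>

definition exp_partial_sum :: "ring_A fps fps \<Rightarrow> nat \<Rightarrow> ring_A fps fps" where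
  "exp_partial_sum G N = (\<Sum>m\<le>N. const2 (scaleQ (1 / fact m) 1) * G ^ m)"

lemma formal_exp_nth:
  assumes "fps_nth G 0 = 0" "b \<le> N"
  shows   "fps_nth (formal_exp G) b = fps_nth (exp_partial_sum G N) b"
proof (rule fps_ext)
  fix a
  let ?t = "\<lambda>m. fps_nth (fps_nth (const2 (scaleQ (1 / fact m) 1) * G ^ m) b) a"
  have "?t m = 0" if "m > b" for m
    using startsby_zero_power_prefix[OF assms(1), of m] that
    by (auto simp: const2_mult_nth simp del: fps_mult_nth_0)
  hence "{m. ?t m \<noteq> 0} \<subseteq> {..N}"
    using assms(2) by (auto simp: not_less[symmetric] simp del: fps_mult_nth_0)
  hence "(\<Sum>m | ?t m \<noteq> 0. ?t m) = (\<Sum>m\<le>N. ?t m)"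
    by (intro sum.mono_neutral_left) (auto simp del: fps_mult_nth_0)
  thus "fps_nth (fps_nth (formal_exp G) b) a = fps_nth (fps_nth (exp_partial_sum G N) b) a"
    by (simp add: formal_exp_def formal_sum_def exp_partial_sum_def fps_sum_nth del: fps_mult_nth_0)
qed

lemma formal_exp_nth_0:
  assumes "fps_nth G 0 = 0"
  shows   "fps_nth (formal_exp G) 0 = 1"
proof -
  have "const2 (scaleQ 1 1) = 1"
    using scaleQ_of_nat[of 1] by (simp add: const2_def)
  thus ?thesis
    by (simp add: formal_exp_nth[OF assms order.refl] exp_partial_sum_def)
qed

lemma fps_deriv_exp_partial_sum:
  "fps_deriv (exp_partial_sum G (Suc N)) = exp_partial_sum G N * fps_deriv G"
proof -
  have const: "const2 (scaleQ (1 / fact (Suc m)) 1) * of_nat (Suc m)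
          = const2 (scaleQ (1 / fact m) 1)" for m
  proof -
    have "scaleQ (1 / fact (Suc m)) 1 * of_nat (Suc m)
            = scaleQ (1 / fact (Suc m)) 1 * scaleQ (of_nat (Suc m)) 1"
      by (simp only: scaleQ_of_nat)
    also have "\<dots> = scaleQ (1 / fact m) 1"
      unfolding scaleQ_scaleQ_one by (simp add: field_simps del: of_nat_Suc)
    finally show ?thesis
      by (simp add: const2_def flip: fps_of_nat del: of_nat_Suc)
  qed
  have step: "fps_deriv (const2 (scaleQ (1 / fact (Suc m)) 1) * G ^ Suc m)
                = const2 (scaleQ (1 / fact m) 1) * G ^ m * fps_deriv G" for m
  proof -
    have "fps_deriv (const2 (scaleQ (1 / fact (Suc m)) 1) * G ^ Suc m)
            = const2 (scaleQ (1 / fact (Suc m)) 1) * fps_deriv (G ^ Suc m)"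
      by (simp only: const2_def fps_deriv_mult_const_left)
    also have "\<dots> = (const2 (scaleQ (1 / fact (Suc m)) 1) * of_nat (Suc m)) * G ^ m * fps_deriv G"
      unfolding fps_deriv_power' by (simp only: diff_Suc_1 mult_ac)
    finally show ?thesis
      by (simp only: const)
  qed
  have const0: "fps_deriv (const2 c * G ^ 0) = 0" for c
    by (simp add: const2_def)
  show ?thesis
    unfolding exp_partial_sum_def sum.atMost_Suc_shift fps_deriv_add fps_deriv_sum step const0
    by (simp add: sum_distrib_right)
qed

lemma fps_deriv_formal_exp:
  assumes "fps_nth G 0 = 0"
  shows   "fps_deriv (formal_exp G) = formal_exp G * fps_deriv G"
proof (rule fps_ext)
  fix b
  have "fps_nth (fps_deriv (formal_exp G)) b = fps_nth (fps_deriv (exp_partial_sum G (Suc b))) b"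
    using formal_exp_nth[OF assms, of "b + 1" "Suc b"] by simp
  also have "\<dots> = fps_nth (exp_partial_sum G b * fps_deriv G) b"
    by (simp only: fps_deriv_exp_partial_sum)
  also have "\<dots> = fps_nth (formal_exp G * fps_deriv G) b"
    using formal_exp_nth[OF assms, of _ b] by (auto simp: fps_mult_nth intro!: sum.cong)
  finally show "fps_nth (fps_deriv (formal_exp G)) b = fps_nth (formal_exp G * fps_deriv G) b" .
qed


section \<open>The coefficients of the power sums\<close>

text \<open>
  For \<open>n \<ge> 1\<close>, Waring's formula says that the coefficient of \<open>x\<^sup>a y\<^sup>b\<close> in \<open>\<gamma>\<^sup>n + \<delta>\<^sup>n\<close>, where \<open>n = a + 2 b\<close>, is
  \<open>(-1)\<^sup>b n / (a + b) (a + b choose b)\<close>. Writing \<open>n = (a + b) + b\<close> turns this into a sum of two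
  binomial coefficients without division; for \<open>b = 0\<close> the value is \<open>1\<close>, except for
  \<open>\<gamma>\<^sup>0 + \<delta>\<^sup>0 = 2\<close>.
\<close>

definition waring_coeff :: "nat \<Rightarrow> nat \<Rightarrow> int" where
  "waring_coeff b a =
     (if b = 0 then if a = 0 then 2 else 1
      else (-1) ^ b * int ((a + b choose b) + (a + b - 1 choose (b - 1))))"

text \<open>
  This is Pascal's rule for both binomial coefficients, and it matches Newton's recursion for the
  power sums. The bound \<open>a + 2 b \<ge> 2\<close> excludes the two initial values of that recursion.
\<close>

lemma waring_coeff_rec:
  assumes "a + 2 * b \<ge> 2"
  shows   "waring_coeff b a = (if a = 0 then 0 else waring_coeff b (a - 1))
                              - (if b = 0 then 0 else waring_coeff (b - 1) a)"
proof (cases a; cases b)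
  fix a' b' assume [simp]: "a = Suc a'" "b = Suc b'"
  show ?thesis
    by (cases b') (auto simp: waring_coeff_def algebra_simps)
next
  fix b' assume [simp]: "a = 0" "b = Suc b'"
  show ?thesis
    by (cases b') (auto simp: waring_coeff_def)
qed (use assms in \<open>auto simp: waring_coeff_def\<close>)

lemma pow_sum_nth:
  "fps_nth (fps_nth (pow_sum n var_x var_y) b) a
     = (if a + 2 * b = n then of_int (waring_coeff b a) else 0 :: 'a :: comm_ring_1)"
proof (cases "a + 2 * b = n")
  case False
  thus ?thesis by (simp add: pow_sum_nth_eq_0)
next
  case True
  have "fps_nth (fps_nth (pow_sum n var_x var_y) b) a = (of_int (waring_coeff b a) :: 'a)"
    using True
  proof (induction n arbitrary: a b rule: induct_nat_012)
    case 0
    have two: "(2 :: 'a fps fps) = const2 2"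
      by (simp add: const2_def numeral_fps_const)
    show ?case using 0 unfolding pow_sum.simps two by (auto simp: const2_def waring_coeff_def)
  next
    case 1
    hence "a = 1 \<and> b = 0" by presburger
    thus ?case by (auto simp: var_x_def fps_X_nth waring_coeff_def)
  next
    case (ge2 n)
    have x: "fps_nth (fps_nth (var_x * F) b) a
               = (if a = 0 then 0 else fps_nth (fps_nth F b) (a - 1))" for F :: "'a fps fps"
      by (simp add: var_x_def)
    have y: "fps_nth (fps_nth (var_y * F) b) a
               = (if b = 0 then 0 else fps_nth (fps_nth F (b - 1)) a)" for F :: "'a fps fps"
      by (simp add: var_y_def)
    show ?case
      using ge2.prems ge2.IH(1)[of a "b - 1"] ge2.IH(2)[of "a - 1" b]
      by (subst waring_coeff_rec) (auto simp: x y simp del: fps_mult_nth_0)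
  qed
  with True show ?thesis by simp
qed

text \<open>
  The factor \<open>b + 1\<close> comes from differentiating \<open>y\<^bsup>b + 1\<^esup>\<close>. It produces the factor
  \<open>n = a + 2 (b + 1)\<close> that cancels the denominator of \<open>\<zeta>(n) / n\<close>.
\<close>

lemma waring_coeff_Suc:
  "int (Suc b) * waring_coeff (Suc b) a
     = - ((-1) ^ b * int (a + b choose b) * int (a + 2 * b + 2))"
proof -
  have "Suc b * (Suc (a + b) choose Suc b) = Suc (a + b) * (a + b choose b)"
    by (rule Suc_times_binomial)
  hence "Suc b * ((Suc (a + b) choose Suc b) + (a + b choose b))
           = (a + b choose b) * (a + 2 * b + 2)"
    by (simp only: distrib_left) (simp add: algebra_simps)
  hence "int (Suc b) * int ((Suc (a + b) choose Suc b) + (a + b choose b))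
           = int (a + b choose b) * int (a + 2 * b + 2)"
    by (simp only: flip: of_nat_mult)
  thus ?thesis
    by (simp add: waring_coeff_def mult.left_commute del: of_nat_Suc of_nat_add binomial_Suc_Suc)
qed


section \<open>Elementary factors and their logarithmic derivatives\<close>

text \<open>
  This is \<open>u\<^sup>2 / (1 - x u)\<close>. Starting at \<open>u\<^sup>2\<close> encodes the condition that all exponents are at least \<open>2\<close>;
  the exponent of \<open>x\<close> counts the excess over \<open>2\<close>.
\<close>

definition geometric_tail :: "'a::comm_ring_1 \<Rightarrow> 'a fps" where
  "geometric_tail u = Abs_fps (\<lambda>k. u ^ (k + 2))"

definition elem_factor :: "'a::comm_ring_1 \<Rightarrow> 'a fps fps" where
  "elem_factor u = 1 + var_y * fps_const (geometric_tail u)"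

text \<open>
  The expansion of \<open>u\<^sup>2 / (1 - x u + y u\<^sup>2)\<close>.
\<close>

definition log_deriv_elem_factor :: "'a::comm_ring_1 \<Rightarrow> 'a fps fps" where
  "log_deriv_elem_factor u =
     Abs_fps (\<lambda>b. Abs_fps (\<lambda>a. (-1) ^ b * of_nat (a + b choose b) * u ^ (a + 2 * b + 2)))"

lemma geometric_tail_eq: "(1 - fps_const u * fps_X) * geometric_tail u = fps_const (u ^ 2)"
proof (rule fps_ext)
  show "fps_nth ((1 - fps_const u * fps_X) * geometric_tail u) a
          = fps_nth (fps_const (u ^ 2)) a" for a
    by (cases a) (simp_all add: algebra_simps geometric_tail_def power2_eq_square)
qed

text \<open>
  In terms of the geometric tail \<open>T\<close>, the series \<open>u\<^sup>2 / (1 - x u + y u\<^sup>2)\<close> equals \<open>T / (1 + y T)\<close>, so that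
  its coefficients with respect to \<open>y\<close> form a geometric progression with ratio \<open>- T\<close>. After
  multiplication by \<open>1 - x u\<close> this is Pascal's rule.
\<close>

lemma log_deriv_elem_factor_nth_Suc:
  "fps_nth (log_deriv_elem_factor u) (Suc b)
     = - (geometric_tail u * fps_nth (log_deriv_elem_factor u) b)"
proof -
  let ?Q = "\<lambda>b. fps_nth (log_deriv_elem_factor u) b"
  \<comment> \<open>The inverse of \<open>1 - x u\<close>, which undoes the multiplication that exposes Pascal's rule.\<close>
  let ?S = "Abs_fps (\<lambda>k. u ^ k)"
  have S: "?S * (1 - fps_const u * fps_X) = 1"
  proof (rule fps_ext)
    show "fps_nth (?S * (1 - fps_const u * fps_X)) a = fps_nth 1 a" for a
      by (cases a) (simp_all add: algebra_simps)
  qed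
  have pascal: "(1 - fps_const u * fps_X) * ?Q (Suc b) = - (fps_const (u ^ 2) * ?Q b)"
  proof (rule fps_ext)
    show "fps_nth ((1 - fps_const u * fps_X) * ?Q (Suc b)) a
            = fps_nth (- (fps_const (u ^ 2) * ?Q b)) a" for a
      by (cases a) (simp_all add: log_deriv_elem_factor_def binomial_eq_0 algebra_simps power2_eq_square)
  qed
  have "?Q (Suc b) = ?S * (1 - fps_const u * fps_X) * ?Q (Suc b)"
    by (simp only: S mult_1)
  also have "\<dots> = - (?S * fps_const (u ^ 2) * ?Q b)"
    by (simp only: mult.assoc pascal mult_minus_right)
  also have "?S * fps_const (u ^ 2) = geometric_tail u"
    using S by (simp only: mult.assoc[symmetric] mult_1 flip: geometric_tail_eq)
  finally show ?thesis .
qed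

lemma fps_deriv_elem_factor:
  "fps_deriv (elem_factor u) = elem_factor u * log_deriv_elem_factor u"
proof -
  have "fps_deriv (elem_factor u) = fps_const (geometric_tail u)"
    by (simp add: elem_factor_def var_y_def)
  moreover have "elem_factor u * log_deriv_elem_factor u = fps_const (geometric_tail u)"
  proof (rule fps_ext)
    fix b
    have "fps_nth (log_deriv_elem_factor u) 0 = geometric_tail u"
      by (simp add: log_deriv_elem_factor_def geometric_tail_def)
    thus "fps_nth (elem_factor u * log_deriv_elem_factor u) b
            = fps_nth (fps_const (geometric_tail u)) b"
      by (cases b)
         (simp_all add: elem_factor_def var_y_def distrib_right mult.assoc log_deriv_elem_factor_nth_Suc)
  qed
  ultimately show ?thesis by simp
qed

lemma fps_deriv_prod_log_deriv:
  fixes f g :: "'b \<Rightarrow> 'a::comm_ring_1 fps"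
  assumes "\<And>i. i \<in> I \<Longrightarrow> fps_deriv (f i) = f i * g i"
  shows   "fps_deriv (\<Prod>i\<in>I. f i) = (\<Prod>i\<in>I. f i) * (\<Sum>i\<in>I. g i)"
  using assms by (induction I rule: infinite_finite_induct) (simp_all add: algebra_simps)


section \<open>Expanding the product over the admissible integers\<close>

text \<open>
  Splitting off the first exponent \<open>j + 2\<close> of an exponent list turns the sum over lists into the
  Cauchy product of the corresponding geometric tails. The remaining exponents have sum at least
  \<open>2 b\<close>, which is why \<open>j \<le> a\<close> and the subtraction \<open>a - j\<close> does not truncate.
\<close>

lemma lists_Suc_sum_eq:
  "{ks. length ks = Suc b \<and> sum_list ks = a + 2 * Suc b \<and> (\<forall>k\<in>set ks. 2 \<le> k)}
     = (\<lambda>(j, ks). (j + 2) # ks) `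
         (SIGMA j:{0..a}. {ks. length ks = b \<and> sum_list ks = a - j + 2 * b \<and> (\<forall>k\<in>set ks. 2 \<le> k)})"
  (is "?L = ?f ` ?R")
proof (intro equalityI subsetI)
  fix ks assume ks: "ks \<in> ?L"
  then obtain k ks' where [simp]: "ks = k # ks'"
    by (cases ks) auto
  have "2 * length ks' \<le> sum_list ks'"
  proof -
    have "(\<Sum>k\<leftarrow>ks'. 2) \<le> (\<Sum>k\<leftarrow>ks'. k)"
      using ks by (intro sum_list_mono) auto
    thus ?thesis by (simp add: sum_list_triv)
  qed
  with ks show "ks \<in> ?f ` ?R"
    by (intro image_eqI[of _ _ "(k - 2, ks')"]) auto
qed auto

lemma prod_list_geometric_tail_nth:
  fixes us :: "'a::comm_ring_1 list"
  shows "fps_nth (\<Prod>u\<leftarrow>us. geometric_tail u) a =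
           (\<Sum>ks | length ks = length us \<and> sum_list ks = a + 2 * length us \<and> (\<forall>k\<in>set ks. 2 \<le> k).
              \<Prod>i<length us. us ! i ^ (ks ! i))"
proof (induction us arbitrary: a)
  case Nil
  have "{ks :: nat list. length ks = length ([] :: 'a list) \<and>
           sum_list ks = a + 2 * length ([] :: 'a list) \<and> (\<forall>k\<in>set ks. 2 \<le> k)}
          = (if a = 0 then {[]} else {})"
    by auto
  thus ?case
    by (simp only:) simp
next
  case (Cons u us)
  let ?I = "\<lambda>a. {ks. length ks = length us \<and> sum_list ks = a + 2 * length us \<and> (\<forall>k\<in>set ks. 2 \<le> k)}"
  have "fps_nth (\<Prod>u\<leftarrow>u # us. geometric_tail u) a =
          (\<Sum>j=0..a. \<Sum>ks\<in>?I (a - j). u ^ (j + 2) * (\<Prod>i<length us. us ! i ^ (ks ! i)))"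
  proof -
    have "fps_nth (geometric_tail u) j = u ^ (j + 2)" for j
      by (simp add: geometric_tail_def)
    thus ?thesis
      by (simp only: list.map prod_list.Cons fps_mult_nth Cons.IH sum_distrib_left)
  qed
  also have "\<dots> = (\<Sum>(j, ks)\<in>(SIGMA j:{0..a}. ?I (a - j)).
                     u ^ (j + 2) * (\<Prod>i<length us. us ! i ^ (ks ! i)))"
    by (intro sum.Sigma ballI finite_fmzv2_sum_index) simp
  also have "\<dots> = (\<Sum>(j, ks)\<in>(SIGMA j:{0..a}. ?I (a - j)).
                     \<Prod>i<Suc (length us). (u # us) ! i ^ (((j + 2) # ks) ! i))"
    by (simp add: prod.lessThan_Suc_shift case_prod_unfold del: prod.lessThan_Suc)
  also have "\<dots> = (\<Sum>ks | length ks = Suc (length us) \<and> sum_list ks = a + 2 * Suc (length us) \<and>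
                       (\<forall>k\<in>set ks. 2 \<le> k). \<Prod>i<Suc (length us). (u # us) ! i ^ (ks ! i))"
    unfolding lists_Suc_sum_eq
    by (subst sum.reindex) (auto simp: inj_on_def case_prod_unfold)
  finally show ?case by simp
qed

lemma fps_const_prod: "(\<Prod>i\<in>I. fps_const (f i)) = fps_const (\<Prod>i\<in>I. f i)"
  by (induction I rule: infinite_finite_induct) simp_all

text \<open>
  Expanding the product gives a sum over the subsets of \<open>N\<close> of size \<open>b\<close>, and such subsets correspond
  to strictly increasing lists of length \<open>b\<close>.
\<close>

lemma prod_one_plus_y_nth:
  fixes f :: "'b::linorder \<Rightarrow> 'a::comm_ring_1 fps"
  assumes "finite N"
  shows "fps_nth (\<Prod>n\<in>N. 1 + var_y * fps_const (f n)) b =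
           (\<Sum>ns | length ns = b \<and> sorted_wrt (<) ns \<and> set ns \<subseteq> N. \<Prod>n\<leftarrow>ns. f n)"
proof -
  have "(\<Prod>n\<in>N. 1 + var_y * fps_const (f n)) = (\<Prod>n\<in>N. var_y * fps_const (f n) + 1)"
    by (simp add: add.commute)
  also have "\<dots> = (\<Sum>T\<in>Pow N. fps_X ^ card T * fps_const (\<Prod>n\<in>T. f n))"
    using assms by (subst prod_add) (simp_all add: var_y_def prod.distrib fps_const_prod)
  also have "fps_nth \<dots> b = (\<Sum>T\<in>Pow N. if card T = b then \<Prod>n\<in>T. f n else 0)"
    unfolding fps_sum_nth
    by (intro sum.cong refl) (auto simp: fps_X_power_mult_nth)
  also have "\<dots> = (\<Sum>T | T \<subseteq> N \<and> card T = b. \<Prod>n\<in>T. f n)"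
    using assms by (intro sum.mono_neutral_cong_right) auto
  also have "\<dots> = (\<Sum>ns | length ns = b \<and> sorted_wrt (<) ns \<and> set ns \<subseteq> N. \<Prod>n\<leftarrow>ns. f n)"
  proof (rule sum.reindex_bij_witness[of _ set sorted_list_of_set])
    fix T assume T: "T \<in> {T. T \<subseteq> N \<and> card T = b}"
    hence fin: "finite T" using assms finite_subset by blast
    thus "set (sorted_list_of_set T) = T" by simp
    show "sorted_list_of_set T \<in> {ns. length ns = b \<and> sorted_wrt (<) ns \<and> set ns \<subseteq> N}"
      using T fin by simp
    show "(\<Prod>n\<leftarrow>sorted_list_of_set T. f n) = (\<Prod>n\<in>T. f n)"
      using fin by (simp flip: prod.distinct_set_conv_list)
  next
    fix ns assume ns: "ns \<in> {ns. length ns = b \<and> sorted_wrt (<) ns \<and> set ns \<subseteq> N}"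
    thus "sorted_list_of_set (set ns) = ns"
      using sorted_list_of_set_unique[of "set ns" ns]
      by (auto simp: distinct_card strict_sorted_iff)
    show "set ns \<in> {T. T \<subseteq> N \<and> card T = b}"
      using ns by (auto simp: distinct_card strict_sorted_iff)
  qed
  finally show ?thesis .
qed

definition fmzv2_product :: "nat \<Rightarrow> int fps fps" where
  "fmzv2_product p =
     (\<Prod>n | 0 < n \<and> 2 * n < p. elem_factor (modular_inverse (int p) (int n)))"

lemma finite_admissible: "finite {n. 0 < n \<and> 2 * n < (p :: nat)}"
  by (rule finite_subset[of _ "{..p}"]) auto

text \<open>
  The product over the admissible integers is the generating function of the integer
  representatives of the finite multiple zeta values, on the nose and not just modulo \<open>p\<close>:
  expanding it chooses first the increasing list of integers and then the list of exponents,
  and the two finite sums may be interchanged.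
\<close>

lemma fmzv2_product_nth:
  "fps_nth (fps_nth (fmzv2_product p) b) a =
     (\<Sum>ks | length ks = b \<and> sum_list ks = a + 2 * b \<and> (\<forall>k\<in>set ks. 2 \<le> k). fmzv2_residue ks p)"
proof -
  let ?u = "\<lambda>n. modular_inverse (int p) (int n)"
  let ?Ns = "{ns. length ns = b \<and> sorted_wrt (<) ns \<and> (\<forall>n\<in>set ns. 0 < n \<and> 2 * n < p)}"
  let ?Ks = "{ks. length ks = b \<and> sum_list ks = a + 2 * b \<and> (\<forall>k\<in>set ks. 2 \<le> k)}"
  have Ns: "?Ns = {ns. length ns = b \<and> sorted_wrt (<) ns \<and> set ns \<subseteq> {n. 0 < n \<and> 2 * n < p}}"
    by auto
  have "fps_nth (fps_nth (fmzv2_product p) b) a =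
          (\<Sum>ns\<in>?Ns. fps_nth (\<Prod>u\<leftarrow>map ?u ns. geometric_tail u) a)"
    unfolding fmzv2_product_def elem_factor_def prod_one_plus_y_nth[OF finite_admissible] Ns
      fps_sum_nth by (simp add: comp_def)
  also have "\<dots> = (\<Sum>ns\<in>?Ns. \<Sum>ks\<in>?Ks. \<Prod>i<length ks. ?u (ns ! i) ^ (ks ! i))"
    unfolding prod_list_geometric_tail_nth by (intro sum.cong refl prod.cong) auto
  also have "\<dots> = (\<Sum>ks\<in>?Ks. \<Sum>ns\<in>?Ns. \<Prod>i<length ks. ?u (ns ! i) ^ (ks ! i))"
    by (rule sum.swap)
  also have "\<dots> = (\<Sum>ks\<in>?Ks. fmzv2_residue ks p)"
    unfolding fmzv2_residue_def by (intro sum.cong refl) auto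
  finally show ?thesis .
qed

text \<open>
  In depth one the values are plain power sums, which are what the logarithmic derivatives of the
  factors add up to.
\<close>

lemma fmzv2_residue_singleton:
  "fmzv2_residue [k] p = (\<Sum>n | 0 < n \<and> 2 * n < p. modular_inverse (int p) (int n) ^ k)"
  unfolding fmzv2_residue_def
  by (rule sum.reindex_bij_witness[of _ "\<lambda>n. [n]" hd])
     (auto simp: length_Suc_conv)

definition log_deriv_fmzv2_product :: "nat \<Rightarrow> int fps fps" where
  "log_deriv_fmzv2_product p =
     (\<Sum>n | 0 < n \<and> 2 * n < p. log_deriv_elem_factor (modular_inverse (int p) (int n)))"

lemma fps_deriv_fmzv2_product:
  "fps_deriv (fmzv2_product p) = fmzv2_product p * log_deriv_fmzv2_product p"
  unfolding fmzv2_product_def log_deriv_fmzv2_product_def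
  by (rule fps_deriv_prod_log_deriv) (rule fps_deriv_elem_factor)

lemma log_deriv_fmzv2_product_nth:
  "fps_nth (fps_nth (log_deriv_fmzv2_product p) b) a =
     (-1) ^ b * int (a + b choose b) * fmzv2_residue [a + 2 * b + 2] p"
  by (simp add: log_deriv_fmzv2_product_def log_deriv_elem_factor_def fps_sum_nth
                fmzv2_residue_singleton sum_distrib_left)


section \<open>Passing from families of integer series to series over the quotient ring\<close>

text \<open>
  The coefficientwise quotient map from families of series in \<open>\<int>[[x,y]]\<close> to \<open>\<A>[[x,y]]\<close>. It
  respects products since every coefficient of a product is a finite expression in the coefficients
  of the factors.
\<close>

definition series_of_family :: "(nat \<Rightarrow> int fps fps) \<Rightarrow> ring_A fps fps" where
  "series_of_family \<Phi> =
     Abs_fps (\<lambda>b. Abs_fps (\<lambda>a. abs_ring_A (\<lambda>p. fps_nth (fps_nth (\<Phi> p) b) a)))"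

lemma abs_ring_A_sum: "abs_ring_A (\<lambda>p. \<Sum>i\<in>I. f i p) = (\<Sum>i\<in>I. abs_ring_A (f i))"
  by (induction I rule: infinite_finite_induct)
     (simp_all add: zero_ring_A.abs_eq flip: plus_ring_A.abs_eq)

lemma abs_ring_A_of_nat: "abs_ring_A (\<lambda>p. of_nat n) = of_nat n"
  by (induction n) (simp_all add: zero_ring_A.abs_eq one_ring_A.abs_eq flip: plus_ring_A.abs_eq)

lemma series_of_family_mult:
  "series_of_family (\<lambda>p. \<Phi> p * \<Psi> p) = series_of_family \<Phi> * series_of_family \<Psi>"
  by (rule fps_ext, rule fps_ext)
     (simp add: series_of_family_def fps_mult_nth fps_sum_nth abs_ring_A_sum times_ring_A.abs_eq
           del: fps_mult_nth_0)

lemma of_nat_mult_fps_nth: "fps_nth (of_nat n * F) a = of_nat n * fps_nth F a"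
  by (simp flip: fps_of_nat)

lemma fps_deriv_series_of_family:
  "fps_deriv (series_of_family \<Phi>) = series_of_family (\<lambda>p. fps_deriv (\<Phi> p))"
  by (rule fps_ext, rule fps_ext)
     (simp add: series_of_family_def of_nat_mult_fps_nth times_ring_A.abs_eq
           del: fps_mult_nth_0 of_nat_Suc flip: abs_ring_A_of_nat)


section \<open>The generating function of the sums of level-two finite multiple zeta values\<close>

lemma formal_sum_nth_single:
  assumes "\<And>i. i \<in> I \<Longrightarrow> i \<noteq> k \<Longrightarrow> fps_nth (fps_nth (F i) b) a = 0"
  shows   "fps_nth (fps_nth (formal_sum I F) b) a
             = (if k \<in> I then fps_nth (fps_nth (F k) b) a else 0)"
proof -
  have "{i. i \<in> I \<and> fps_nth (fps_nth (F i) b) a \<noteq> 0}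
          = (if k \<in> I \<and> fps_nth (fps_nth (F k) b) a \<noteq> 0 then {k} else {})"
    using assms by auto
  thus ?thesis
    by (simp add: formal_sum_def)
qed

text \<open>
  The empty zeta value supplies the isolated summand \<open>1\<close> of the generating function as its
  part of depth \<open>0\<close>.
\<close>

lemma fmzv2_sum_depth_0: "fmzv2_sum k 0 = (if k = 0 then 1 else 0)"
proof -
  have "{ns :: nat list. length ns = length ([] :: nat list) \<and> sorted_wrt (<) ns \<and>
           (\<forall>n\<in>set ns. 0 < n \<and> 2 * n < p)} = {[]}" for p
    by auto
  hence "fmzv2_residue [] = (\<lambda>_. 1)"
    unfolding fmzv2_residue_def by (simp only:) simp
  hence "fmzv2 [] = 1"
    by (simp add: fmzv2.abs_eq one_ring_A.abs_eq)
  moreover have "{ks :: nat list. length ks = 0 \<and> sum_list ks = k \<and> (\<forall>j\<in>set ks. 2 \<le> j)}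
                   = (if k = 0 then {[]} else {})"
    by auto
  ultimately show ?thesis
    by (simp add: fmzv2_sum_def del: length_0_conv)
qed

lemma generating_function_eq_series_of_family:
  "1 + formal_sum {1..} (\<lambda>r. formal_sum {2 * r..}
         (\<lambda>k. const2 (fmzv2_sum k r) * var_x ^ (k - 2 * r) * var_y ^ r))
     = series_of_family fmzv2_product"  (is "1 + formal_sum _ ?inner = _")
proof (rule fps_ext, rule fps_ext)
  fix a b
  have inner: "fps_nth (fps_nth (?inner r) b) a = (if r = b then fmzv2_sum (a + 2 * b) b else 0)" for r
    by (subst formal_sum_nth_single[where k = "a + 2 * r"]) (auto simp: monomial2_nth)
  have "fps_nth (fps_nth (formal_sum {1..} ?inner) b) a
          = (if b \<in> {1..} then fps_nth (fps_nth (?inner b) b) a else 0)"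
    by (rule formal_sum_nth_single) (simp add: inner)
  hence "fps_nth (fps_nth (1 + formal_sum {1..} ?inner) b) a = fmzv2_sum (a + 2 * b) b"
    by (cases "b = 0") (auto simp: inner fmzv2_sum_depth_0 simp del: One_nat_def)
  also have "\<dots> = fps_nth (fps_nth (series_of_family fmzv2_product) b) a"
    by (simp add: series_of_family_def fmzv2_product_nth abs_ring_A_sum fmzv2_sum_def fmzv2.abs_eq)
  finally show "fps_nth (fps_nth (1 + formal_sum {1..} ?inner) b) a
                  = fps_nth (fps_nth (series_of_family fmzv2_product) b) a" .
qed

definition fmzv2_exponent :: "ring_A fps fps" where
  "fmzv2_exponent = formal_sum {1..}
     (\<lambda>n. const2 (scaleQ (1 / of_nat n) (fmzv2 [n])) * (var_x ^ n - pow_sum n var_x var_y))"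

lemma fmzv2_exponent_nth:
  "fps_nth (fps_nth fmzv2_exponent b) a =
     (if b = 0 then 0
      else - (scaleQ (1 / of_nat (a + 2 * b)) (fmzv2 [a + 2 * b]) * of_int (waring_coeff b a)))"
  unfolding fmzv2_exponent_def
  by (subst formal_sum_nth_single[where k = "a + 2 * b"])
     (auto simp: const2_mult_nth var_x_power_nth pow_sum_nth waring_coeff_def
           simp del: fps_mult_nth_0)

text \<open>
  Only \<open>n = a + 2 (b + 1)\<close> contributes to the coefficient of \<open>x\<^sup>a y\<^sup>b\<close> in the derivative of the exponent,
  and there the factor \<open>n\<close> supplied by Waring's formula cancels \<open>1/n\<close>.
\<close>

lemma fps_deriv_fmzv2_exponent:
  "fps_deriv fmzv2_exponent = series_of_family log_deriv_fmzv2_product"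
proof (rule fps_ext, rule fps_ext)
  fix a b :: nat
  let ?n = "a + 2 * b + 2"
  let ?c = "(-1) ^ b * int (a + b choose b)"
  have "fps_nth (fps_nth (fps_deriv fmzv2_exponent) b) a =
          - (of_int (int (Suc b) * waring_coeff (Suc b) a) * scaleQ (1 / of_nat ?n) (fmzv2 [?n]))"
    by (simp add: fmzv2_exponent_nth of_nat_mult_fps_nth mult_ac
             del: of_nat_Suc fps_mult_nth_0 flip: Suc_eq_plus1)
  also have "\<dots> = of_int ?c * (of_nat ?n * scaleQ (1 / of_nat ?n) (fmzv2 [?n]))"
    unfolding waring_coeff_Suc by (simp add: mult.assoc del: of_nat_Suc of_nat_add)
  also have "\<dots> = of_int ?c * fmzv2 [?n]"
    by (subst of_nat_mult_scaleQ_inverse) simp_all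
  also have "of_int ?c = abs_ring_A (\<lambda>p. ?c)"
    by (cases "even b")
       (simp_all add: abs_ring_A_of_nat flip: uminus_ring_A.abs_eq)
  finally show "fps_nth (fps_nth (fps_deriv fmzv2_exponent) b) a =
          fps_nth (fps_nth (series_of_family log_deriv_fmzv2_product) b) a"
    by (simp add: series_of_family_def log_deriv_fmzv2_product_nth fmzv2.abs_eq times_ring_A.abs_eq)
qed

theorem corollary3p8:
  shows "1 + formal_sum {1..} (\<lambda>r. formal_sum {2 * r..}
               (\<lambda>k. const2 (fmzv2_sum k r) * var_x ^ (k - 2 * r) * var_y ^ r))
         = formal_exp (formal_sum {1..}
             (\<lambda>n. const2 (scaleQ (1 / of_nat n) (fmzv2 [n])) *
                    (var_x ^ n - pow_sum n var_x var_y)))"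
  unfolding generating_function_eq_series_of_family fmzv2_exponent_def[symmetric]
proof (rule logarithmic_derivative_unique)
  have exponent_0: "fps_nth fmzv2_exponent 0 = 0"
    by (rule fps_ext) (simp add: fmzv2_exponent_nth)
  show "fps_deriv (formal_exp fmzv2_exponent)
          = formal_exp fmzv2_exponent * series_of_family log_deriv_fmzv2_product"
    by (simp only: fps_deriv_formal_exp[OF exponent_0] fps_deriv_fmzv2_exponent)
  show "fps_deriv (series_of_family fmzv2_product)
          = series_of_family fmzv2_product * series_of_family log_deriv_fmzv2_product"
    by (simp only: fps_deriv_series_of_family fps_deriv_fmzv2_product series_of_family_mult)
  show "fps_nth (series_of_family fmzv2_product) 0 = fps_nth (formal_exp fmzv2_exponent) 0"
  proof (rule fps_ext)
    fix a
    have "fps_nth (fps_nth (series_of_family fmzv2_product) 0) a = fmzv2_sum a 0"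
      by (simp add: series_of_family_def fmzv2_product_nth abs_ring_A_sum fmzv2_sum_def
                    fmzv2.abs_eq del: length_0_conv)
    thus "fps_nth (fps_nth (series_of_family fmzv2_product) 0) a
            = fps_nth (fps_nth (formal_exp fmzv2_exponent) 0) a"
      by (simp add: fmzv2_sum_depth_0 formal_exp_nth_0[OF exponent_0])
  qed
qed

end
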